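(* Let $C$ be a Frobenius algebra in a Karoubian monoidal category. Let $(B,m_B,e_B)$ be a unital subalgebra of $C$, with unital algebra monomorphism $i_B:B\to C$, and with a left dual. Then $(B,i_B,i_B^* )$ is an ambiently selfdual subobject of $C$ if and only if $(B,m_B,e_B,m_B^*,e_B^* )$ is a Frobenius subalgebra of $C$ (with multiplication $m_B$, unit $e_B$, comultiplication $m_B^*$ and counit $e_B^*$).
   Context: Monoidal categories are taken strict; Karoubian means every idempotent splits. A left dual of $X$ is $(X^*,\mathrm{ev}_X:X^*\otimes X\to\mathbf 1,\mathrm{coev}_X:\mathbf 1\to X\otimes X^* )$ satisfying the zigzag identities; $f^*:Y^*\to X^*$ is the dual of $f:X\to Y$ (with $(X\otimes Y)^*=Y^*\otimes X^*$). A Frobenius algebra is $(X,m,\delta,e,\epsilon)$ with $(X,m,e)$ a unital algebra, $(X,\delta,\epsilon)$ a counital coalgebra and $(\mathrm{id}_X\otimes m)\circ(\delta\otimes \mathrm{id}_X)=\delta\circ m=(m\otimes \mathrm{id}_X)\circ(\mathrm{id}_X\otimes\delta)$. It is always regarded as selfdual, $X^*=X$, with $\mathrm{ev}_X=\epsilon\circ m$, $\mathrm{coev}_X=\delta\circ e$. A unital algebra morphism $f$ from $(X',m',e')$ to $(X,m,e)$ satisfies $f\circ e'=e$, $m\circ(f\otimes f)=f\circ m'$. A Frobenius algebra $X'$ is a Frobenius subalgebra of $X$ if there is a unital algebra monomorphism $i:X'\to X$ with $i^{**}=i$ and $i^*\circ i=\mathrm{id}_{X'}$; here the monomorphism is $i_B$.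 Ambient selfduality: let $C=C^*$ be selfdual and $(B,i,p)$ a split subobject ($i:B\to C$, $p:C\to B$, $p\circ i=\mathrm{id}_B$), $b=i\circ p$. Split $b^*\in\mathrm{End}(C^* )$ as $b^*=i'\circ p'$, $p'\circ i'=\mathrm{id}_{B'}$; the ambient dual of $B$ is $(B',\mathrm{ev}_C\circ(i'\otimes i),(p\otimes p')\circ\mathrm{coev}_C)$ (for this dual $i^*=p'$, $p^*=i'$). $(B,i,p)$ is ambiently selfdual if it coincides with its ambient dual, i.e. one may take $B'=B$, $i'=i$, $p'=p$; in this case $i^*=p$ and $i^{**}=p^*=i$, so $i\circ i^*=b$, $i^*\circ i=\mathrm{id}_B$. *)

theory Defs
  imports Main
begin

section \<open>Strict monoidal categories\<close>

record ('o, 'm) smc =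
  objs :: "'o set"
  arrs :: "'m set"
  src :: "'m \<Rightarrow> 'o"
  trg :: "'m \<Rightarrow> 'o"
  ident :: "'o \<Rightarrow> 'm"  ("Idt\<index>")
  compose :: "'m \<Rightarrow> 'm \<Rightarrow> 'm"  (infixr "\<cdot>\<index>" 65)
  unit_ob :: "'o"  ("\<one>\<index>")
  tensor_ob :: "'o \<Rightarrow> 'o \<Rightarrow> 'o"  (infixr "\<boxtimes>\<index>" 75)
  tensor :: "'m \<Rightarrow> 'm \<Rightarrow> 'm"  (infixr "\<otimes>\<index>" 70)

text \<open>Composition is written in the usual order, \<open>g \<cdot> f\<close> being first \<open>f\<close>, then \<open>g\<close>. The operations
  are total functions, and only their values on arguments of matching type are constrained.\<close>

definition hom :: "('o, 'm, 'x) smc_scheme \<Rightarrow> 'o \<Rightarrow> 'o \<Rightarrow> 'm set" where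
  "hom M X Y = {f \<in> arrs M. src M f = X \<and> trg M f = Y}"

locale strict_monoidal_category =
  fixes M :: "('o, 'm, 'x) smc_scheme" (structure)
  assumes src_in: "f \<in> arrs M \<Longrightarrow> src M f \<in> objs M"
    and trg_in: "f \<in> arrs M \<Longrightarrow> trg M f \<in> objs M"
    and ident_in: "X \<in> objs M \<Longrightarrow> Idt X \<in> hom M X X"
    and compose_in: "f \<in> hom M X Y \<Longrightarrow> g \<in> hom M Y Z \<Longrightarrow> g \<cdot> f \<in> hom M X Z"
    and compose_ident_left: "f \<in> hom M X Y \<Longrightarrow> Idt Y \<cdot> f = f"
    and compose_ident_right: "f \<in> hom M X Y \<Longrightarrow> f \<cdot> Idt X = f"
    and compose_assoc:
      "f \<in> hom M X Y \<Longrightarrow> g \<in> hom M Y Z \<Longrightarrow> h \<in> hom M Z W \<Longrightarrow> (h \<cdot> g) \<cdot> f = h \<cdot> (g \<cdot> f)"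
    and unit_in: "\<one> \<in> objs M"
    and tensor_ob_in: "X \<in> objs M \<Longrightarrow> Y \<in> objs M \<Longrightarrow> X \<boxtimes> Y \<in> objs M"
    and tensor_ob_assoc:
      "X \<in> objs M \<Longrightarrow> Y \<in> objs M \<Longrightarrow> Z \<in> objs M \<Longrightarrow> (X \<boxtimes> Y) \<boxtimes> Z = X \<boxtimes> (Y \<boxtimes> Z)"
    and tensor_ob_unit_left: "X \<in> objs M \<Longrightarrow> \<one> \<boxtimes> X = X"
    and tensor_ob_unit_right: "X \<in> objs M \<Longrightarrow> X \<boxtimes> \<one> = X"
    and tensor_in:
      "f \<in> hom M X Y \<Longrightarrow> g \<in> hom M Z W \<Longrightarrow> f \<otimes> g \<in> hom M (X \<boxtimes> Z) (Y \<boxtimes> W)"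
    and tensor_ident: "X \<in> objs M \<Longrightarrow> Y \<in> objs M \<Longrightarrow> Idt X \<otimes> Idt Y = Idt (X \<boxtimes> Y)"
    and tensor_compose:
      "f \<in> hom M X Y \<Longrightarrow> g \<in> hom M Y Z \<Longrightarrow> f' \<in> hom M X' Y' \<Longrightarrow> g' \<in> hom M Y' Z' \<Longrightarrow>
        (g \<cdot> f) \<otimes> (g' \<cdot> f') = (g \<otimes> g') \<cdot> (f \<otimes> f')"
    and tensor_assoc:
      "f \<in> arrs M \<Longrightarrow> g \<in> arrs M \<Longrightarrow> h \<in> arrs M \<Longrightarrow> (f \<otimes> g) \<otimes> h = f \<otimes> (g \<otimes> h)"
    and tensor_unit_left: "f \<in> arrs M \<Longrightarrow> Idt \<one> \<otimes> f = f"
    and tensor_unit_right: "f \<in> arrs M \<Longrightarrow> f \<otimes> Idt \<one> = f"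

definition splits :: "('o, 'm, 'x) smc_scheme \<Rightarrow> 'o \<Rightarrow> 'm \<Rightarrow> 'o \<Rightarrow> 'm \<Rightarrow> 'm \<Rightarrow> bool" where
  "splits M X a B i p \<longleftrightarrow>
     B \<in> objs M \<and> i \<in> hom M B X \<and> p \<in> hom M X B \<and> p \<cdot> i = Idt B \<and> i \<cdot> p = a"
  for M (structure)

locale karoubian_strict_monoidal_category = strict_monoidal_category +
  assumes idempotents_split:
    "X \<in> objs M \<Longrightarrow> a \<in> hom M X X \<Longrightarrow> a \<cdot> a = a \<Longrightarrow> \<exists>B i p. splits M X a B i p"

definition monic :: "('o, 'm, 'x) smc_scheme \<Rightarrow> 'o \<Rightarrow> 'o \<Rightarrow> 'm \<Rightarrow> bool" where
  "monic M X Y f \<longleftrightarrow>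
     f \<in> hom M X Y \<and>
     (\<forall>Z \<in> objs M. \<forall>g \<in> hom M Z X. \<forall>h \<in> hom M Z X. f \<cdot> g = f \<cdot> h \<longrightarrow> g = h)"
  for M (structure)

section \<open>Left duals\<close>

record ('o, 'm) dual_data =
  dual_ob :: "'o"
  ev :: "'m"
  coev :: "'m"

definition left_dual :: "('o, 'm, 'x) smc_scheme \<Rightarrow> 'o \<Rightarrow> ('o, 'm) dual_data \<Rightarrow> bool" where
  "left_dual M X D \<longleftrightarrow>
     X \<in> objs M \<and> dual_ob D \<in> objs M \<and>
     ev D \<in> hom M (dual_ob D \<boxtimes> X) \<one> \<and>
     coev D \<in> hom M \<one> (X \<boxtimes> dual_ob D) \<and>
     (Idt X \<otimes> ev D) \<cdot> (coev D \<otimes> Idt X) = Idt X \<and>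
     (ev D \<otimes> Idt (dual_ob D)) \<cdot> (Idt (dual_ob D) \<otimes> coev D) = Idt (dual_ob D)"
  for M (structure)

definition selfduality :: "('o, 'm, 'x) smc_scheme \<Rightarrow> 'o \<Rightarrow> ('o, 'm) dual_data \<Rightarrow> bool" where
  "selfduality M X D \<longleftrightarrow> left_dual M X D \<and> dual_ob D = X"

text \<open>The dual \<open>f\<^sup>*: Y\<^sup>* \<rightarrow> X\<^sup>*\<close> of \<open>f: X \<rightarrow> Y\<close>, with respect to left duals \<open>DX\<close> of \<open>X\<close> and \<open>DY\<close> of \<open>Y\<close>.\<close>

definition dual_mor ::
    "('o, 'm, 'x) smc_scheme \<Rightarrow> ('o, 'm) dual_data \<Rightarrow> ('o, 'm) dual_data \<Rightarrow> 'm \<Rightarrow> 'm" where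
  "dual_mor M DX DY f =
     (ev DY \<otimes> Idt (dual_ob DX)) \<cdot> (Idt (dual_ob DY) \<otimes> f \<otimes> Idt (dual_ob DX)) \<cdot>
     (Idt (dual_ob DY) \<otimes> coev DX)"
  for M (structure)

definition unit_dual :: "('o, 'm, 'x) smc_scheme \<Rightarrow> ('o, 'm) dual_data" where
  "unit_dual M = \<lparr>dual_ob = \<one>, ev = Idt \<one>, coev = Idt \<one>\<rparr>"
  for M (structure)

text \<open>The left dual \<open>(X \<otimes> Y)\<^sup>* = Y\<^sup>* \<otimes> X\<^sup>*\<close> induced by left duals \<open>DX\<close> of \<open>X\<close> and \<open>DY\<close> of \<open>Y\<close>.\<close>

definition tensor_dual ::
    "('o, 'm, 'x) smc_scheme \<Rightarrow> 'o \<Rightarrow> ('o, 'm) dual_data \<Rightarrow> 'o \<Rightarrow> ('o, 'm) dual_data \<Rightarrow>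
      ('o, 'm) dual_data" where
  "tensor_dual M X DX Y DY =
     \<lparr>dual_ob = dual_ob DY \<boxtimes> dual_ob DX,
      ev = ev DY \<cdot> (Idt (dual_ob DY) \<otimes> ev DX \<otimes> Idt Y),
      coev = (Idt X \<otimes> coev DY \<otimes> Idt (dual_ob DX)) \<cdot> coev DX\<rparr>"
  for M (structure)

section \<open>Algebras and Frobenius algebras\<close>

record ('o, 'm) algebra_data =
  ob :: "'o"
  mult :: "'m"
  unt :: "'m"

record ('o, 'm) frobenius_data = "('o, 'm) algebra_data" +
  comult :: "'m"
  counit :: "'m"

definition unital_algebra ::
    "('o, 'm, 'x) smc_scheme \<Rightarrow> ('o, 'm, 'y) algebra_data_scheme \<Rightarrow> bool" where
  "unital_algebra M A \<longleftrightarrow>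
     ob A \<in> objs M \<and>
     mult A \<in> hom M (ob A \<boxtimes> ob A) (ob A) \<and>
     unt A \<in> hom M \<one> (ob A) \<and>
     mult A \<cdot> (mult A \<otimes> Idt (ob A)) = mult A \<cdot> (Idt (ob A) \<otimes> mult A) \<and>
     mult A \<cdot> (unt A \<otimes> Idt (ob A)) = Idt (ob A) \<and>
     mult A \<cdot> (Idt (ob A) \<otimes> unt A) = Idt (ob A)"
  for M (structure)

definition counital_coalgebra ::
    "('o, 'm, 'x) smc_scheme \<Rightarrow> ('o, 'm, 'y) frobenius_data_scheme \<Rightarrow> bool" where
  "counital_coalgebra M A \<longleftrightarrow>
     ob A \<in> objs M \<and>
     comult A \<in> hom M (ob A) (ob A \<boxtimes> ob A) \<and>
     counit A \<in> hom M (ob A) \<one> \<and>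
     (comult A \<otimes> Idt (ob A)) \<cdot> comult A = (Idt (ob A) \<otimes> comult A) \<cdot> comult A \<and>
     (counit A \<otimes> Idt (ob A)) \<cdot> comult A = Idt (ob A) \<and>
     (Idt (ob A) \<otimes> counit A) \<cdot> comult A = Idt (ob A)"
  for M (structure)

definition frobenius_algebra ::
    "('o, 'm, 'x) smc_scheme \<Rightarrow> ('o, 'm, 'y) frobenius_data_scheme \<Rightarrow> bool" where
  "frobenius_algebra M A \<longleftrightarrow>
     unital_algebra M A \<and> counital_coalgebra M A \<and>
     (Idt (ob A) \<otimes> mult A) \<cdot> (comult A \<otimes> Idt (ob A)) = comult A \<cdot> mult A \<and>
     comult A \<cdot> mult A = (mult A \<otimes> Idt (ob A)) \<cdot> (Idt (ob A) \<otimes> comult A)"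
  for M (structure)

text \<open>The selfduality that every Frobenius algebra is regarded as carrying.\<close>

definition frobenius_dual ::
    "('o, 'm, 'x) smc_scheme \<Rightarrow> ('o, 'm, 'y) frobenius_data_scheme \<Rightarrow> ('o, 'm) dual_data" where
  "frobenius_dual M A =
     \<lparr>dual_ob = ob A, ev = counit A \<cdot> mult A, coev = comult A \<cdot> unt A\<rparr>"
  for M (structure)

definition unital_algebra_morphism ::
    "('o, 'm, 'x) smc_scheme \<Rightarrow> ('o, 'm, 'y) algebra_data_scheme \<Rightarrow>
      ('o, 'm, 'z) algebra_data_scheme \<Rightarrow> 'm \<Rightarrow> bool" where
  "unital_algebra_morphism M A' A f \<longleftrightarrow>
     f \<in> hom M (ob A') (ob A) \<and>
     f \<cdot> unt A' = unt A \<and>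
     mult A \<cdot> (f \<otimes> f) = f \<cdot> mult A'"
  for M (structure)

definition unital_algebra_mono ::
    "('o, 'm, 'x) smc_scheme \<Rightarrow> ('o, 'm, 'y) algebra_data_scheme \<Rightarrow>
      ('o, 'm, 'z) algebra_data_scheme \<Rightarrow> 'm \<Rightarrow> bool" where
  "unital_algebra_mono M A' A f \<longleftrightarrow>
     unital_algebra_morphism M A' A f \<and> monic M (ob A') (ob A) f"

text \<open>\<open>A'\<close> is a Frobenius subalgebra of \<open>A\<close> through the monomorphism \<open>i\<close>. The duals
  \<open>i\<^sup>*: A \<rightarrow> A'\<close> and \<open>i\<^sup>*\<^sup>*: A' \<rightarrow> A\<close> are formed with the Frobenius selfdualities.\<close>

definition frobenius_subalgebra ::
    "('o, 'm, 'x) smc_scheme \<Rightarrow> ('o, 'm, 'y) frobenius_data_scheme \<Rightarrow> 'm \<Rightarrow>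
      ('o, 'm, 'z) frobenius_data_scheme \<Rightarrow> bool" where
  "frobenius_subalgebra M A' i A \<longleftrightarrow>
     frobenius_algebra M A' \<and> frobenius_algebra M A \<and>
     unital_algebra_mono M A' A i \<and>
     (let D' = frobenius_dual M A'; D = frobenius_dual M A; i_star = dual_mor M D' D i in
        dual_mor M D D' i_star = i \<and> i_star \<cdot> i = Idt (ob A'))"
  for M (structure)

text \<open>For an algebra \<open>B\<close> with a left dual \<open>D\<close>, the data \<open>(B, m\<^sub>B, e\<^sub>B, m\<^sub>B\<^sup>*, e\<^sub>B\<^sup>*)\<close>. Here
  \<open>m\<^sub>B\<^sup>*: B\<^sup>* \<rightarrow> B\<^sup>* \<otimes> B\<^sup>*\<close> and \<open>e\<^sub>B\<^sup>*: B\<^sup>* \<rightarrow> \<one>\<close>, so these can only be a comultiplication and a counit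
  on \<open>B\<close> when \<open>B\<^sup>* = B\<close>.\<close>

definition dual_frobenius_data ::
    "('o, 'm, 'x) smc_scheme \<Rightarrow> ('o, 'm) algebra_data \<Rightarrow> ('o, 'm) dual_data \<Rightarrow>
      ('o, 'm) frobenius_data" where
  "dual_frobenius_data M B D =
     \<lparr>ob = ob B, mult = mult B, unt = unt B,
      comult = dual_mor M (tensor_dual M (ob B) D (ob B) D) D (mult B),
      counit = dual_mor M (unit_dual M) D (unt B)\<rparr>"

text \<open>Since \<open>m\<^sub>B\<^sup>*\<close> and \<open>e\<^sub>B\<^sup>*\<close> depend on the left dual \<open>D\<close> of \<open>B\<close>, while a Frobenius algebra is always
  regarded as selfdual through \<open>\<epsilon> \<circ> m\<close> and \<open>\<delta> \<circ> e\<close>, using the star in one sense only means that \<open>D\<close>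
  is that selfduality. This is not automatic: on \<open>k \<times> k\<close> with the trace \<open>\<epsilon>\<close> and the swap \<open>\<sigma>\<close>, the
  selfduality \<open>ev = \<epsilon> \<circ> m \<circ> (\<sigma> \<otimes> id)\<close> makes \<open>m\<^sup>*\<close> and \<open>e\<^sup>*\<close> the usual \<open>\<delta>\<close> and \<open>\<epsilon>\<close>, but differs from
  \<open>\<epsilon> \<circ> m\<close>.\<close>

definition frobenius_subalgebra_by_dual ::
    "('o, 'm, 'x) smc_scheme \<Rightarrow> ('o, 'm) algebra_data \<Rightarrow> ('o, 'm) dual_data \<Rightarrow> 'm \<Rightarrow>
      ('o, 'm, 'z) frobenius_data_scheme \<Rightarrow> bool" where
  "frobenius_subalgebra_by_dual M B D i C \<longleftrightarrow>
     D = frobenius_dual M (dual_frobenius_data M B D) \<and>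
     frobenius_subalgebra M (dual_frobenius_data M B D) i C"

section \<open>Ambient selfduality\<close>

definition split_subobject :: "('o, 'm, 'x) smc_scheme \<Rightarrow> 'o \<Rightarrow> 'o \<Rightarrow> 'm \<Rightarrow> 'm \<Rightarrow> bool" where
  "split_subobject M X B i p \<longleftrightarrow>
     B \<in> objs M \<and> i \<in> hom M B X \<and> p \<in> hom M X B \<and> p \<cdot> i = Idt B"
  for M (structure)

text \<open>Let \<open>D\<close> be a selfduality of \<open>X\<close>, \<open>(B, i, p)\<close> a split subobject of \<open>X\<close>, and \<open>b = i \<cdot> p\<close>. An ambient
  dual of \<open>B\<close> is obtained from a splitting \<open>b\<^sup>* = i' \<cdot> p'\<close> through \<open>B'\<close>; it is the left dual \<open>D'\<close>
  of \<open>B\<close> below.\<close>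

definition ambient_dual ::
    "('o, 'm, 'x) smc_scheme \<Rightarrow> ('o, 'm) dual_data \<Rightarrow> 'm \<Rightarrow> 'm \<Rightarrow>
      'o \<Rightarrow> 'm \<Rightarrow> 'm \<Rightarrow> ('o, 'm) dual_data \<Rightarrow> bool" where
  "ambient_dual M D i p B' i' p' D' \<longleftrightarrow>
     splits M (dual_ob D) (dual_mor M D D (i \<cdot> p)) B' i' p' \<and>
     D' = \<lparr>dual_ob = B', ev = ev D \<cdot> (i' \<otimes> i), coev = (p \<otimes> p') \<cdot> coev D\<rparr>"
  for M (structure)

definition ambiently_selfdual ::
    "('o, 'm, 'x) smc_scheme \<Rightarrow> 'o \<Rightarrow> ('o, 'm) dual_data \<Rightarrow> 'o \<Rightarrow> 'm \<Rightarrow> 'm \<Rightarrow> bool" where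
  "ambiently_selfdual M X D B i p \<longleftrightarrow>
     selfduality M X D \<and> split_subobject M X B i p \<and>
     (\<exists>B' i' p' D'. ambient_dual M D i p B' i' p' D' \<and> B' = B \<and> i' = i \<and> p' = p)"

end

theory Submission
  imports Defs
begin

text \<open>
  Write \<open>i\<close> for the inclusion of \<open>B\<close> into \<open>C\<close>, let \<open>D\<close> be the given left dual of \<open>B\<close>, and let
  \<open>p = i\<^sup>*\<close>. By definition \<open>p\<close> is the only morphism with \<open>ev\<^sub>D \<circ> (p \<otimes> id) = ev\<^sub>C \<circ> (id \<otimes> i)\<close>. Both sides of
  the equivalence amount to saying that \<open>B\<^sup>* = B\<close>, that \<open>p \<circ> i = id\<close> and that \<open>p\<^sup>* = i\<close>. Two facts bring them to
  this common form.

  First, for the idempotent \<open>b = i \<circ> p\<close> contravariance gives \<open>b\<^sup>* = p\<^sup>* \<circ> i\<^sup>* = p\<^sup>* \<circ> p\<close>, and \<open>p\<close> has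
  the right inverse \<open>i\<close>, so \<open>b\<^sup>* = b\<close> says exactly that \<open>p\<^sup>* = i\<close>
  (\<open>dual_retract_selfadjoint_iff\<close>).

  Second, if \<open>p \<circ> i = id\<close>, then composing the defining equation of \<open>p\<close> with \<open>i \<otimes> id\<close> shows that
  \<open>ev\<^sub>D = ev\<^sub>C \<circ> (i \<otimes> i) = \<epsilon>\<^sub>C \<circ> i \<circ> m\<^sub>B\<close>. By associativity this pairing is invariant: moving the
  multiplication from one of its arguments to the other does not change it
  (\<open>invariant_duality_pullback\<close>). An algebra whose evaluation pairing is invariant is a Frobenius
  algebra with comultiplication \<open>m\<^sub>B\<^sup>*\<close> and counit \<open>e\<^sub>B\<^sup>*\<close>, and the selfduality of this Frobenius algebra
  is the duality one started from (\<open>frobenius_algebra_dual_frobenius_data\<close>,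
  \<open>frobenius_dual_dual_frobenius_data\<close>).
\<close>

section \<open>Calculating in a strict monoidal category\<close>

context strict_monoidal_category
begin

text \<open>The axioms are restated for source and target instead of hom sets, since the simplifier can then
  compute the types of composite diagrams. Compositions and tensor products associate to the right,
  and the identity of a tensor product is split into identities.\<close>

lemma ident_typing [simp]:
  assumes "X \<in> objs M"
  shows "Idt X \<in> arrs M" "src M (Idt X) = X" "trg M (Idt X) = X"
  using ident_in[OF assms] by (simp_all add: hom_def)

lemma compose_typing [simp]:
  assumes "f \<in> arrs M" "g \<in> arrs M" "src M g = trg M f"
  shows "g \<cdot> f \<in> arrs M" "src M (g \<cdot> f) = src M f" "trg M (g \<cdot> f) = trg M g"
  using compose_in[of f "src M f" "trg M f" g "trg M g"] assms by (simp_all add: hom_def)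

lemma tensor_typing [simp]:
  assumes "f \<in> arrs M" "g \<in> arrs M"
  shows "f \<otimes> g \<in> arrs M" "src M (f \<otimes> g) = src M f \<boxtimes> src M g" "trg M (f \<otimes> g) = trg M f \<boxtimes> trg M g"
  using tensor_in[of f "src M f" "trg M f" g "src M g" "trg M g"] assms by (simp_all add: hom_def)

lemmas strict_monoidal_simps [simp] =
  src_in trg_in unit_in tensor_ob_in tensor_ob_assoc tensor_ob_unit_left tensor_ob_unit_right
  tensor_assoc tensor_unit_left tensor_unit_right tensor_ident[symmetric]

lemma compose_ident_simps [simp]:
  "f \<in> arrs M \<Longrightarrow> trg M f = Y \<Longrightarrow> Idt Y \<cdot> f = f"
  "f \<in> arrs M \<Longrightarrow> src M f = X \<Longrightarrow> f \<cdot> Idt X = f"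
  using compose_ident_left[of f "src M f" Y] compose_ident_right[of f X "trg M f"]
  by (simp_all add: hom_def)

lemma compose_assoc_simp [simp]:
  "f \<in> arrs M \<Longrightarrow> g \<in> arrs M \<Longrightarrow> h \<in> arrs M \<Longrightarrow> src M g = trg M f \<Longrightarrow> src M h = trg M g \<Longrightarrow>
    (h \<cdot> g) \<cdot> f = h \<cdot> (g \<cdot> f)"
  using compose_assoc[of f "src M f" "trg M f" g "trg M g" h "trg M h"]
  by (simp add: hom_def)

lemma interchange [simp]:
  assumes "f \<in> arrs M" "g \<in> arrs M" "f' \<in> arrs M" "g' \<in> arrs M"
    and "src M g = trg M f" "src M g' = trg M f'"
  shows "(g \<otimes> g') \<cdot> (f \<otimes> f') = (g \<cdot> f) \<otimes> (g' \<cdot> f')"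
  using tensor_compose[of f "src M f" "trg M f" g "trg M g" f' "src M f'" "trg M f'" g' "trg M g'"]
    assms by (simp add: hom_def)

text \<open>Since tensor products associate to the right, the interchange law does not match where one factor
  meets two neighbouring factors of the other side; these instances are covered separately.\<close>

lemma interchange_flat [simp]:
  assumes "a \<in> arrs M" "b \<in> arrs M" "h \<in> arrs M" "f \<in> arrs M" "f' \<in> arrs M"
  shows "src M f = trg M a \<boxtimes> trg M b \<Longrightarrow> src M f' = trg M h \<Longrightarrow>
      (f \<otimes> f') \<cdot> (a \<otimes> b \<otimes> h) = (f \<cdot> (a \<otimes> b)) \<otimes> (f' \<cdot> h)"
    and "src M a \<boxtimes> src M b = trg M f \<Longrightarrow> src M h = trg M f' \<Longrightarrow>
      (a \<otimes> b \<otimes> h) \<cdot> (f \<otimes> f') = ((a \<otimes> b) \<cdot> f) \<otimes> (h \<cdot> f')"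
  using interchange[of "a \<otimes> b" f h f'] interchange[of f "a \<otimes> b" f' h] assms by simp_all

lemmas interchanges = interchange interchange_flat

lemma compose_ident_tensor [simp]:
  assumes "X \<in> objs M" "Y \<in> objs M" "f \<in> arrs M"
  shows "src M f = X \<boxtimes> Y \<Longrightarrow> f \<cdot> (Idt X \<otimes> Idt Y) = f"
    and "trg M f = X \<boxtimes> Y \<Longrightarrow> (Idt X \<otimes> Idt Y) \<cdot> f = f"
  using compose_ident_simps[of f "X \<boxtimes> Y"] assms by simp_all

text \<open>Diagrams are calculated in two forms. With the interchange laws, layers are merged as far as
  possible; this form shows that two morphisms can be moved past each other. With the rules below in
  place of the interchange laws, a diagram is cut into as many layers as possible; this form shows that
  two diagrams differ only by the grouping of their layers.\<close>

lemma whisker: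
  assumes "f \<in> arrs M" "g \<in> arrs M" "src M g = trg M f" "X \<in> objs M"
  shows "Idt X \<otimes> (g \<cdot> f) = (Idt X \<otimes> g) \<cdot> (Idt X \<otimes> f)"
    and "(g \<cdot> f) \<otimes> Idt X = (g \<otimes> Idt X) \<cdot> (f \<otimes> Idt X)"
    and "Y \<in> objs M \<Longrightarrow> (g \<cdot> f) \<otimes> Idt X \<otimes> Idt Y = (g \<otimes> Idt X \<otimes> Idt Y) \<cdot> (f \<otimes> Idt X \<otimes> Idt Y)"
  using assms by simp_all

text \<open>A morphism out of the unit object has no input strand, so it can be slid past any \<open>f\<close>, although \<open>f\<close>
  on its own shows no tensor factor to which the interchange law could apply.\<close>

lemma slide_unit:
  assumes "c \<in> arrs M" "src M c = \<one>" "f \<in> arrs M" "X \<in> objs M"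
  shows "trg M f = X \<Longrightarrow> (c \<otimes> Idt X) \<cdot> f = c \<otimes> f"
    and "trg M f = X \<Longrightarrow> (Idt X \<otimes> c) \<cdot> f = f \<otimes> c"
    and "Y \<in> objs M \<Longrightarrow> trg M f = X \<boxtimes> Y \<Longrightarrow> (c \<otimes> Idt X \<otimes> Idt Y) \<cdot> f = c \<otimes> f"
    and "Y \<in> objs M \<Longrightarrow> trg M f = X \<boxtimes> Y \<Longrightarrow> (Idt X \<otimes> Idt Y \<otimes> c) \<cdot> f = f \<otimes> c"
  using interchange[of "Idt \<one>" c f "Idt (trg M f)"] interchange[of f "Idt (trg M f)" "Idt \<one>" c]
    assms by simp_all

section \<open>Left duals and dual morphisms\<close>

text \<open>Bending the strand of \<open>X\<close> upwards turns \<open>h: Z \<otimes> X \<rightarrow> \<one>\<close> into a morphism \<open>Z \<rightarrow> X\<^sup>*\<close>. The two zigzag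
  identities make this inverse to \<open>g \<mapsto> ev \<circ> (g \<otimes> id)\<close>, so that morphisms into a dual can be compared
  through the pairing.\<close>

definition transpose :: "('o, 'm) dual_data \<Rightarrow> 'o \<Rightarrow> 'm \<Rightarrow> 'm" where
  "transpose D Z h = (h \<otimes> Idt (dual_ob D)) \<cdot> (Idt Z \<otimes> coev D)"

lemma left_dual_typing:
  assumes "left_dual M X D"
  shows "X \<in> objs M" "dual_ob D \<in> objs M"
    "ev D \<in> arrs M" "src M (ev D) = dual_ob D \<boxtimes> X" "trg M (ev D) = \<one>"
    "coev D \<in> arrs M" "src M (coev D) = \<one>" "trg M (coev D) = X \<boxtimes> dual_ob D"
  using assms by (simp_all add: left_dual_def hom_def)

lemma left_dual_zigzag:
  assumes "left_dual M X D"
  shows "(Idt X \<otimes> ev D) \<cdot> (coev D \<otimes> Idt X) = Idt X"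
    "(ev D \<otimes> Idt (dual_ob D)) \<cdot> (Idt (dual_ob D) \<otimes> coev D) = Idt (dual_ob D)"
  using assms by (simp_all add: left_dual_def)

lemma transpose_ev:
  assumes D: "left_dual M X D" and g: "g \<in> hom M Z (dual_ob D)"
  shows "transpose D Z (ev D \<cdot> (g \<otimes> Idt X)) = g"
proof -
  note [simp] = left_dual_typing[OF D]
  have [simp]: "g \<in> arrs M" "src M g = Z" "trg M g = dual_ob D" using g by (auto simp: hom_def)
  have [simp]: "Z \<in> objs M" using src_in[of g] by simp
  have "transpose D Z (ev D \<cdot> (g \<otimes> Idt X)) =
      ((ev D \<otimes> Idt (dual_ob D)) \<cdot> (g \<otimes> Idt (X \<boxtimes> dual_ob D))) \<cdot> (Idt Z \<otimes> coev D)"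
    using interchange[of "g \<otimes> Idt X" "ev D" "Idt (dual_ob D)" "Idt (dual_ob D)"]
    by (simp add: transpose_def del: interchange)
  also have "\<dots> = (ev D \<otimes> Idt (dual_ob D)) \<cdot> (g \<otimes> coev D)"
    by (simp del: tensor_ident[symmetric])
  also have "\<dots> = (ev D \<otimes> Idt (dual_ob D)) \<cdot> ((Idt (dual_ob D) \<otimes> coev D) \<cdot> (g \<otimes> Idt \<one>))"
    by (subst interchange) (simp_all)
  also have "\<dots> = ((ev D \<otimes> Idt (dual_ob D)) \<cdot> (Idt (dual_ob D) \<otimes> coev D)) \<cdot> (g \<otimes> Idt \<one>)"
    by (subst compose_assoc_simp) (simp_all)
  also have "\<dots> = g" by (simp add: left_dual_zigzag[OF D] del: compose_assoc_simp)
  finally show ?thesis .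
qed

lemma ev_transpose:
  assumes D: "left_dual M X D" and Z [simp]: "Z \<in> objs M" and h: "h \<in> hom M (Z \<boxtimes> X) \<one>"
  shows "ev D \<cdot> (transpose D Z h \<otimes> Idt X) = h"
proof -
  note [simp] = left_dual_typing[OF D]
  have [simp]: "h \<in> arrs M" "src M h = Z \<boxtimes> X" "trg M h = \<one>" using h by (auto simp: hom_def)
  have "transpose D Z h \<otimes> Idt X =
      ((h \<otimes> Idt (dual_ob D)) \<otimes> Idt X) \<cdot> ((Idt Z \<otimes> coev D) \<otimes> Idt X)"
    unfolding transpose_def by (subst interchange) simp_all
  then have "ev D \<cdot> (transpose D Z h \<otimes> Idt X) =
      ((Idt \<one> \<otimes> ev D) \<cdot> (h \<otimes> Idt (dual_ob D \<boxtimes> X))) \<cdot> (Idt Z \<otimes> coev D \<otimes> Idt X)"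
    by simp
  also have "(Idt \<one> \<otimes> ev D) \<cdot> (h \<otimes> Idt (dual_ob D \<boxtimes> X)) =
      (h \<otimes> Idt \<one>) \<cdot> (Idt (Z \<boxtimes> X) \<otimes> ev D)"
    by (subst (1 2) interchange) (simp_all del: tensor_ident[symmetric] tensor_unit_left tensor_unit_right)
  also have "((h \<otimes> Idt \<one>) \<cdot> (Idt (Z \<boxtimes> X) \<otimes> ev D)) \<cdot> (Idt Z \<otimes> coev D \<otimes> Idt X) =
      h \<cdot> (Idt Z \<otimes> ((Idt X \<otimes> ev D) \<cdot> (coev D \<otimes> Idt X)))"
    by simp
  also have "\<dots> = h"
    by (simp add: left_dual_zigzag[OF D])
  finally show ?thesis .
qed

lemma dual_mor_eq_transpose:
  assumes X: "left_dual M X DX" and Y: "left_dual M Y DY" and f: "f \<in> hom M X Y"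
  shows "dual_mor M DX DY f = transpose DX (dual_ob DY) (ev DY \<cdot> (Idt (dual_ob DY) \<otimes> f))"
proof -
  note [simp] = left_dual_typing[OF X] left_dual_typing[OF Y]
  have [simp]: "f \<in> arrs M" "src M f = X" "trg M f = Y" using f by (auto simp: hom_def)
  have "(ev DY \<cdot> (Idt (dual_ob DY) \<otimes> f)) \<otimes> Idt (dual_ob DX) =
      (ev DY \<otimes> Idt (dual_ob DX)) \<cdot> ((Idt (dual_ob DY) \<otimes> f) \<otimes> Idt (dual_ob DX))"
    by (subst interchange) simp_all
  then show ?thesis
    by (simp add: dual_mor_def transpose_def whisker del: interchanges)
qed

text \<open>As a transpose, \<open>f\<^sup>*\<close> is characterised by adjointness with respect to the two pairings. Contravariance
  and the identification of \<open>ev D\<close> with a restricted pairing are read off from this.\<close>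

lemma
  assumes X: "left_dual M X DX" and Y: "left_dual M Y DY" and f: "f \<in> hom M X Y"
  shows dual_mor_in: "dual_mor M DX DY f \<in> hom M (dual_ob DY) (dual_ob DX)"
    and ev_dual_mor: "ev DX \<cdot> (dual_mor M DX DY f \<otimes> Idt X) = ev DY \<cdot> (Idt (dual_ob DY) \<otimes> f)"
    and dual_mor_unique: "\<And>g. g \<in> hom M (dual_ob DY) (dual_ob DX) \<Longrightarrow>
      ev DX \<cdot> (g \<otimes> Idt X) = ev DY \<cdot> (Idt (dual_ob DY) \<otimes> f) \<Longrightarrow> dual_mor M DX DY f = g"
proof -
  note [simp] = left_dual_typing[OF X] left_dual_typing[OF Y]
  have [simp]: "f \<in> arrs M" "src M f = X" "trg M f = Y" using f by (auto simp: hom_def)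
  show "dual_mor M DX DY f \<in> hom M (dual_ob DY) (dual_ob DX)"
    by (simp add: dual_mor_eq_transpose[OF X Y f] transpose_def hom_def)
  show "ev DX \<cdot> (dual_mor M DX DY f \<otimes> Idt X) = ev DY \<cdot> (Idt (dual_ob DY) \<otimes> f)"
    unfolding dual_mor_eq_transpose[OF X Y f]
    by (rule ev_transpose[OF X]) (simp_all add: hom_def)
  show "dual_mor M DX DY f = g" if "g \<in> hom M (dual_ob DY) (dual_ob DX)"
    "ev DX \<cdot> (g \<otimes> Idt X) = ev DY \<cdot> (Idt (dual_ob DY) \<otimes> f)" for g
    unfolding dual_mor_eq_transpose[OF X Y f] that(2)[symmetric]
    by (rule transpose_ev[OF X that(1)])
qed

lemma dual_mor_compose:
  assumes X: "left_dual M X DX" and Y: "left_dual M Y DY" and Z: "left_dual M Z DZ"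
    and f: "f \<in> hom M X Y" and g: "g \<in> hom M Y Z"
  shows "dual_mor M DX DZ (g \<cdot> f) = dual_mor M DX DY f \<cdot> dual_mor M DY DZ g"
proof (rule dual_mor_unique[OF X Z])
  let ?f = "dual_mor M DX DY f" and ?g = "dual_mor M DY DZ g"
  note [simp] = left_dual_typing[OF X] left_dual_typing[OF Y] left_dual_typing[OF Z]
  have [simp]: "f \<in> arrs M" "src M f = X" "trg M f = Y" "g \<in> arrs M" "src M g = Y" "trg M g = Z"
    using f g by (auto simp: hom_def)
  have [simp]: "?f \<in> arrs M" "src M ?f = dual_ob DY" "trg M ?f = dual_ob DX"
    "?g \<in> arrs M" "src M ?g = dual_ob DZ" "trg M ?g = dual_ob DY"
    using dual_mor_in[OF X Y f] dual_mor_in[OF Y Z g] by (auto simp: hom_def)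
  show "g \<cdot> f \<in> hom M X Z" "?f \<cdot> ?g \<in> hom M (dual_ob DZ) (dual_ob DX)"
    by (simp_all add: hom_def)
  have "ev DX \<cdot> ((?f \<cdot> ?g) \<otimes> Idt X) = (ev DX \<cdot> (?f \<otimes> Idt X)) \<cdot> (?g \<otimes> Idt X)"
    by simp
  also have "\<dots> = (ev DY \<cdot> (?g \<otimes> Idt Y)) \<cdot> (Idt (dual_ob DZ) \<otimes> f)"
    unfolding ev_dual_mor[OF X Y f] by simp
  also have "\<dots> = ev DZ \<cdot> (Idt (dual_ob DZ) \<otimes> (g \<cdot> f))"
    unfolding ev_dual_mor[OF Y Z g] by simp
  finally show "ev DX \<cdot> ((?f \<cdot> ?g) \<otimes> Idt X) = ev DZ \<cdot> (Idt (dual_ob DZ) \<otimes> (g \<cdot> f))" .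
qed

text \<open>Contravariance turns \<open>(i \<circ> i\<^sup>*)\<^sup>*\<close> into \<open>i\<^sup>*\<^sup>* \<circ> i\<^sup>*\<close>, and \<open>i\<^sup>*\<close> can be cancelled on the right because it is
  a split epimorphism.\<close>

lemma dual_retract_selfadjoint_iff:
  assumes B: "left_dual M X D" and C: "left_dual M Y E" and E: "dual_ob E = Y" and D: "dual_ob D = X"
    and i: "i \<in> hom M X Y" and retract: "dual_mor M D E i \<cdot> i = Idt X"
  shows "dual_mor M E E (i \<cdot> dual_mor M D E i) = i \<cdot> dual_mor M D E i \<longleftrightarrow>
    dual_mor M E D (dual_mor M D E i) = i"
proof -
  let ?p = "dual_mor M D E i" and ?j = "dual_mor M E D (dual_mor M D E i)"
  have p: "?p \<in> hom M Y X" using dual_mor_in[OF B C i] D E by simp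
  have j: "?j \<in> hom M X Y" using dual_mor_in[OF C B p] D E by simp
  have [simp]: "i \<in> arrs M" "src M i = X" "trg M i = Y" "?p \<in> arrs M" "src M ?p = Y" "trg M ?p = X"
    "?j \<in> arrs M" "src M ?j = X" "trg M ?j = Y"
    using i p j by (auto simp: hom_def)
  have *: "dual_mor M E E (i \<cdot> ?p) = ?j \<cdot> ?p"
    by (rule dual_mor_compose[OF C B C p i])
  show ?thesis
  proof
    assume "dual_mor M E E (i \<cdot> ?p) = i \<cdot> ?p"
    then have "(?j \<cdot> ?p) \<cdot> i = (i \<cdot> ?p) \<cdot> i"
      unfolding * by simp
    then show "?j = i"
      by (simp add: retract)
  qed (simp add: *)
qed

section \<open>Frobenius algebras are selfdual\<close>

lemma frobenius_dual_simps [simp]: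
  "dual_ob (frobenius_dual M A) = ob A" "ev (frobenius_dual M A) = counit A \<cdot> mult A"
  "coev (frobenius_dual M A) = comult A \<cdot> unt A"
  by (simp_all add: frobenius_dual_def)

text \<open>Each zigzag is a Frobenius relation \<open>\<delta> \<circ> m\<close> capped off by the unit at the bottom and the counit at
  the top, so it collapses to the identity by the unit and counit laws.\<close>

lemma left_dual_frobenius_dual:
  assumes "frobenius_algebra M A"
  shows "left_dual M (ob A) (frobenius_dual M A)"
proof -
  let ?I = "Idt (ob A)"
  have alg: "unital_algebra M A" and coalg: "counital_coalgebra M A"
    and frob: "(?I \<otimes> mult A) \<cdot> (comult A \<otimes> ?I) = comult A \<cdot> mult A"
      "(mult A \<otimes> ?I) \<cdot> (?I \<otimes> comult A) = comult A \<cdot> mult A"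
    using assms by (simp_all add: frobenius_algebra_def)
  have [simp]: "ob A \<in> objs M" "mult A \<in> arrs M" "src M (mult A) = ob A \<boxtimes> ob A"
    "trg M (mult A) = ob A" "unt A \<in> arrs M" "src M (unt A) = \<one>" "trg M (unt A) = ob A"
    "comult A \<in> arrs M" "src M (comult A) = ob A" "trg M (comult A) = ob A \<boxtimes> ob A"
    "counit A \<in> arrs M" "src M (counit A) = ob A" "trg M (counit A) = \<one>"
    using alg coalg by (auto simp: unital_algebra_def counital_coalgebra_def hom_def)
  have unit: "mult A \<cdot> (unt A \<otimes> ?I) = ?I" "mult A \<cdot> (?I \<otimes> unt A) = ?I"
    and counit: "(counit A \<otimes> ?I) \<cdot> comult A = ?I" "(?I \<otimes> counit A) \<cdot> comult A = ?I"
    using alg coalg by (simp_all add: unital_algebra_def counital_coalgebra_def)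
  have "(?I \<otimes> (counit A \<cdot> mult A)) \<cdot> ((comult A \<cdot> unt A) \<otimes> ?I) =
      ((?I \<otimes> counit A) \<cdot> (?I \<otimes> mult A)) \<cdot> ((comult A \<otimes> ?I) \<cdot> (unt A \<otimes> ?I))"
    by (subst (1 2) interchange) simp_all
  also have "\<dots> = (?I \<otimes> counit A) \<cdot> ((?I \<otimes> mult A) \<cdot> (comult A \<otimes> ?I)) \<cdot> (unt A \<otimes> ?I)"
    by (simp del: interchange)
  also have "\<dots> = ((?I \<otimes> counit A) \<cdot> comult A) \<cdot> (mult A \<cdot> (unt A \<otimes> ?I))"
    unfolding frob by simp
  also have "\<dots> = ?I"
    unfolding unit counit by simp
  finally have zigzag1:
    "(?I \<otimes> (counit A \<cdot> mult A)) \<cdot> ((comult A \<cdot> unt A) \<otimes> ?I) = ?I" .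
  have "((counit A \<cdot> mult A) \<otimes> ?I) \<cdot> (?I \<otimes> (comult A \<cdot> unt A)) =
      ((counit A \<otimes> ?I) \<cdot> (mult A \<otimes> ?I)) \<cdot> ((?I \<otimes> comult A) \<cdot> (?I \<otimes> unt A))"
    by (subst (1 2) interchange) simp_all
  also have "\<dots> = (counit A \<otimes> ?I) \<cdot> ((mult A \<otimes> ?I) \<cdot> (?I \<otimes> comult A)) \<cdot> (?I \<otimes> unt A)"
    by (simp del: interchange)
  also have "\<dots> = ((counit A \<otimes> ?I) \<cdot> comult A) \<cdot> (mult A \<cdot> (?I \<otimes> unt A))"
    unfolding frob by simp
  also have "\<dots> = ?I"
    unfolding unit counit by simp
  finally show ?thesis using zigzag1
    by (simp add: left_dual_def hom_def)
qed

end

section \<open>Algebras with an invariant duality\<close>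

text \<open>This is the description of Frobenius algebras by an associative nondegenerate form, where
  nondegeneracy is the existence of the copairing \<open>coev D\<close>. The comultiplication and the counit are
  derived from it.\<close>

locale invariant_duality = strict_monoidal_category M
  for M :: "('o, 'm, 'x) smc_scheme" (structure) +
  fixes A :: "('o, 'm) algebra_data" and D :: "('o, 'm) dual_data"
  assumes alg: "unital_algebra M A"
    and dual: "left_dual M (ob A) D"
    and dual_ob [simp]: "dual_ob D = ob A"
    and invariant: "ev D \<cdot> (mult A \<otimes> Idt (ob A)) = ev D \<cdot> (Idt (ob A) \<otimes> mult A)"
begin

abbreviation "B \<equiv> ob A"
abbreviation "I \<equiv> Idt B"
abbreviation "m \<equiv> mult A"
abbreviation "e \<equiv> unt A"
abbreviation "c \<equiv> coev D"

lemma typing [simp]: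
  "B \<in> objs M" "m \<in> arrs M" "src M m = B \<boxtimes> B" "trg M m = B"
  "e \<in> arrs M" "src M e = \<one>" "trg M e = B"
  "ev D \<in> arrs M" "src M (ev D) = B \<boxtimes> B" "trg M (ev D) = \<one>"
  "c \<in> arrs M" "src M c = \<one>" "trg M c = B \<boxtimes> B"
  using alg left_dual_typing[OF dual] by (auto simp: unital_algebra_def hom_def)

lemma algebra_laws:
  "m \<cdot> (m \<otimes> I) = m \<cdot> (I \<otimes> m)" "m \<cdot> (e \<otimes> I) = I" "m \<cdot> (I \<otimes> e) = I"
  using alg by (auto simp: unital_algebra_def)

lemma zigzag: "(I \<otimes> ev D) \<cdot> (c \<otimes> I) = I" "(ev D \<otimes> I) \<cdot> (I \<otimes> c) = I"
  using left_dual_zigzag[OF dual] by simp_all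

text \<open>These formulas describe \<open>m\<^sup>*\<close> and \<open>e\<^sup>*\<close>, as \<open>dual_mult\<close> and \<open>dual_unit\<close> show; the Frobenius
  axioms are easier to verify for them than for the dual morphisms.\<close>

definition \<delta> where "\<delta> = (m \<otimes> I) \<cdot> (I \<otimes> c)"
definition \<kappa> where "\<kappa> = ev D \<cdot> (I \<otimes> e)"

lemma delta_kappa_typing [simp]:
  "\<delta> \<in> arrs M" "src M \<delta> = B" "trg M \<delta> = B \<boxtimes> B" "\<kappa> \<in> arrs M" "src M \<kappa> = B" "trg M \<kappa> = \<one>"
  by (simp_all add: \<delta>_def \<kappa>_def)

text \<open>The product \<open>x y\<close> paired with the unit equals \<open>x\<close> paired with \<open>y e\<close>, by invariance.\<close>

lemma counit_mult: "\<kappa> \<cdot> m = ev D"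
proof -
  have "\<kappa> \<cdot> m = ev D \<cdot> ((I \<otimes> e) \<cdot> (m \<otimes> Idt \<one>))"
    by (simp add: \<kappa>_def del: interchange)
  also have "(I \<otimes> e) \<cdot> (m \<otimes> Idt \<one>) = (m \<otimes> I) \<cdot> ((I \<otimes> I) \<otimes> e)"
    by (subst (1 2) interchange) simp_all
  also have "ev D \<cdot> (m \<otimes> I) \<cdot> ((I \<otimes> I) \<otimes> e) = (ev D \<cdot> (m \<otimes> I)) \<cdot> (I \<otimes> I \<otimes> e)"
    by (simp del: interchanges)
  also have "\<dots> = ev D \<cdot> (I \<otimes> (m \<cdot> (I \<otimes> e)))"
    unfolding invariant by simp
  finally show ?thesis by (simp add: algebra_laws)
qed

text \<open>Transposing the invariance equation in its last argument: the left side is the transpose of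
  \<open>ev \<circ> (m \<otimes> id)\<close>, which is \<open>m\<close>. Below, invariance enters
  only through this equation and \<open>counit_mult\<close>.\<close>

lemma transpose_invariant: "((ev D \<cdot> (I \<otimes> m)) \<otimes> I) \<cdot> (I \<otimes> I \<otimes> c) = m"
  using transpose_ev[OF dual, of m "B \<boxtimes> B"]
  by (simp add: hom_def transpose_def invariant)

text \<open>The dual of \<open>m\<close> consists of two nested copairings \<open>c\<close> below one pairing. Pairing, multiplication and
  inner copairing together form the left side of \<open>transpose_invariant\<close>.\<close>

lemma dual_mult: "dual_mor M (tensor_dual M B D B D) D m = \<delta>"
proof -
  have "dual_mor M (tensor_dual M B D B D) D m =
      (ev D \<otimes> I \<otimes> I) \<cdot> (I \<otimes> m \<otimes> I \<otimes> I) \<cdot> (I \<otimes> ((I \<otimes> c \<otimes> I) \<cdot> c))"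
    by (simp add: dual_mor_def tensor_dual_def del: interchanges)
  also have "\<dots> = ((((ev D \<cdot> (I \<otimes> m)) \<otimes> I) \<cdot> (I \<otimes> I \<otimes> c)) \<otimes> I) \<cdot> (I \<otimes> c)"
    by (simp add: whisker del: interchanges)
  also have "\<dots> = \<delta>"
    by (simp only: transpose_invariant \<delta>_def)
  finally show ?thesis .
qed

lemma dual_unit: "dual_mor M (unit_dual M) D e = \<kappa>"
  by (simp add: dual_mor_def unit_dual_def \<kappa>_def)

text \<open>The copairing inherits invariance from the pairing, so the input of the
  comultiplication may be multiplied into either factor of the copairing. This symmetry gives the
  right counit law, the Frobenius relations and coassociativity.\<close>

lemma delta_eq_left: "\<delta> = (I \<otimes> m) \<cdot> (c \<otimes> I)"
proof -
  have "(I \<otimes> m) \<cdot> (c \<otimes> I) = (I \<otimes> (((ev D \<cdot> (I \<otimes> m)) \<otimes> I) \<cdot> (I \<otimes> I \<otimes> c))) \<cdot> (c \<otimes> I)"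
    by (simp only: transpose_invariant)
  also have "\<dots> = (I \<otimes> ev D \<otimes> I) \<cdot> ((I \<otimes> I \<otimes> \<delta>) \<cdot> (c \<otimes> I))"
    by (simp add: \<delta>_def whisker del: interchanges)
  also have "(I \<otimes> I \<otimes> \<delta>) \<cdot> (c \<otimes> I) = (c \<otimes> I \<otimes> I) \<cdot> \<delta>"
    by (simp add: slide_unit)
  also have "(I \<otimes> ev D \<otimes> I) \<cdot> (c \<otimes> I \<otimes> I) \<cdot> \<delta> = (((I \<otimes> ev D) \<cdot> (c \<otimes> I)) \<otimes> I) \<cdot> \<delta>"
    by (simp add: whisker del: interchanges)
  also have "\<dots> = \<delta>"
    by (simp add: zigzag)
  finally show ?thesis by (rule sym)
qed

lemma delta_unit: "\<delta> \<cdot> e = c"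
proof -
  have "\<delta> \<cdot> e = (m \<otimes> I) \<cdot> ((I \<otimes> c) \<cdot> e)"
    by (simp add: \<delta>_def)
  also have "(I \<otimes> c) \<cdot> e = (e \<otimes> I \<otimes> I) \<cdot> c"
    by (simp add: slide_unit)
  also have "(m \<otimes> I) \<cdot> (e \<otimes> I \<otimes> I) \<cdot> c = ((m \<cdot> (e \<otimes> I)) \<otimes> I) \<cdot> c"
    by (simp add: whisker del: interchanges)
  also have "\<dots> = c" by (simp add: algebra_laws)
  finally show ?thesis .
qed

lemma counit_laws: "(\<kappa> \<otimes> I) \<cdot> \<delta> = I" "(I \<otimes> \<kappa>) \<cdot> \<delta> = I"
proof -
  have "(\<kappa> \<otimes> I) \<cdot> \<delta> = ((\<kappa> \<cdot> m) \<otimes> I) \<cdot> (I \<otimes> c)"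
    by (simp add: \<delta>_def whisker del: interchanges)
  then show "(\<kappa> \<otimes> I) \<cdot> \<delta> = I"
    by (simp only: counit_mult zigzag)
  have "(I \<otimes> \<kappa>) \<cdot> \<delta> = (I \<otimes> (\<kappa> \<cdot> m)) \<cdot> (c \<otimes> I)"
    by (simp add: delta_eq_left whisker del: interchanges)
  then show "(I \<otimes> \<kappa>) \<cdot> \<delta> = I"
    by (simp only: counit_mult zigzag)
qed

text \<open>For each relation, \<open>\<delta>\<close> is taken in the form that creates the copairing on the side away from the
  multiplication; what remains is associativity of \<open>m\<close>.\<close>

lemma frobenius_laws: "(I \<otimes> m) \<cdot> (\<delta> \<otimes> I) = \<delta> \<cdot> m" "(m \<otimes> I) \<cdot> (I \<otimes> \<delta>) = \<delta> \<cdot> m"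
proof -
  have "(I \<otimes> m) \<cdot> (\<delta> \<otimes> I) = (I \<otimes> (m \<cdot> (m \<otimes> I))) \<cdot> (c \<otimes> I \<otimes> I)"
    by (simp add: delta_eq_left whisker del: interchanges)
  also have "\<dots> = (I \<otimes> m) \<cdot> ((I \<otimes> I \<otimes> m) \<cdot> (c \<otimes> I \<otimes> I))"
    by (simp add: algebra_laws whisker del: interchanges)
  also have "(I \<otimes> I \<otimes> m) \<cdot> (c \<otimes> I \<otimes> I) = (c \<otimes> I) \<cdot> m"
    by (simp add: slide_unit)
  also have "(I \<otimes> m) \<cdot> (c \<otimes> I) \<cdot> m = \<delta> \<cdot> m"
    by (simp add: delta_eq_left)
  finally show "(I \<otimes> m) \<cdot> (\<delta> \<otimes> I) = \<delta> \<cdot> m" .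
  have "(m \<otimes> I) \<cdot> (I \<otimes> \<delta>) = ((m \<cdot> (I \<otimes> m)) \<otimes> I) \<cdot> (I \<otimes> I \<otimes> c)"
    by (simp add: \<delta>_def whisker del: interchanges)
  also have "\<dots> = (m \<otimes> I) \<cdot> ((m \<otimes> I \<otimes> I) \<cdot> (I \<otimes> I \<otimes> c))"
    by (simp add: algebra_laws(1)[symmetric] whisker del: interchanges)
  also have "(m \<otimes> I \<otimes> I) \<cdot> (I \<otimes> I \<otimes> c) = (I \<otimes> c) \<cdot> m"
    by (simp add: slide_unit)
  also have "(m \<otimes> I) \<cdot> (I \<otimes> c) \<cdot> m = \<delta> \<cdot> m"
    by (simp add: \<delta>_def)
  finally show "(m \<otimes> I) \<cdot> (I \<otimes> \<delta>) = \<delta> \<cdot> m" .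
qed

text \<open>Both sides multiply the input into the first factor of \<open>(\<delta> \<otimes> id) \<circ> c\<close> or of \<open>(id \<otimes> \<delta>) \<circ> c\<close>. These
  two agree: each consists of two copies of \<open>c\<close> side by side with the two inner factors multiplied.\<close>

lemma coassoc: "(\<delta> \<otimes> I) \<cdot> \<delta> = (I \<otimes> \<delta>) \<cdot> \<delta>"
proof -
  have "(\<delta> \<otimes> I) \<cdot> c = (I \<otimes> m \<otimes> I) \<cdot> ((c \<otimes> I \<otimes> I) \<cdot> c)"
    by (simp add: delta_eq_left whisker del: interchanges)
  also have "(c \<otimes> I \<otimes> I) \<cdot> c = (I \<otimes> I \<otimes> c) \<cdot> c"
    by (simp add: slide_unit)
  also have "(I \<otimes> m \<otimes> I) \<cdot> (I \<otimes> I \<otimes> c) \<cdot> c = (I \<otimes> \<delta>) \<cdot> c"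
    by (simp add: \<delta>_def whisker del: interchanges)
  finally have c: "(\<delta> \<otimes> I) \<cdot> c = (I \<otimes> \<delta>) \<cdot> c" .
  have "(\<delta> \<otimes> I) \<cdot> \<delta> = ((\<delta> \<cdot> m) \<otimes> I) \<cdot> (I \<otimes> c)"
    by (simp add: \<delta>_def whisker del: interchanges)
  also have "\<dots> = (m \<otimes> I \<otimes> I) \<cdot> (I \<otimes> ((\<delta> \<otimes> I) \<cdot> c))"
    unfolding frobenius_laws(2)[symmetric]
    by (simp add: whisker del: interchanges)
  also have "\<dots> = ((m \<otimes> I \<otimes> I) \<cdot> (I \<otimes> I \<otimes> \<delta>)) \<cdot> (I \<otimes> c)"
    unfolding c by (simp add: whisker del: interchanges)
  also have "(m \<otimes> I \<otimes> I) \<cdot> (I \<otimes> I \<otimes> \<delta>) = (I \<otimes> \<delta>) \<cdot> (m \<otimes> I)"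
    by simp
  also have "((I \<otimes> \<delta>) \<cdot> (m \<otimes> I)) \<cdot> (I \<otimes> c) = (I \<otimes> \<delta>) \<cdot> \<delta>"
    by (simp add: \<delta>_def whisker del: interchanges)
  finally show ?thesis .
qed

lemma dual_frobenius_data_eq:
  "dual_frobenius_data M A D = \<lparr>ob = B, mult = m, unt = e, comult = \<delta>, counit = \<kappa>\<rparr>"
  by (simp add: dual_frobenius_data_def dual_mult dual_unit)

lemma frobenius_algebra_dual_frobenius_data: "frobenius_algebra M (dual_frobenius_data M A D)"
  using alg counit_laws frobenius_laws coassoc
  by (simp add: dual_frobenius_data_eq frobenius_algebra_def unital_algebra_def
      counital_coalgebra_def hom_def)

lemma frobenius_dual_dual_frobenius_data: "frobenius_dual M (dual_frobenius_data M A D) = D"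
  by (simp add: dual_frobenius_data_eq frobenius_dual_def counit_mult delta_unit)

end

section \<open>Subalgebras of a Frobenius algebra\<close>

context strict_monoidal_category
begin

text \<open>If \<open>i\<^sup>*\<close> is a retraction of \<open>i\<close>, the adjointness that defines \<open>i\<^sup>*\<close> identifies the pairing on \<open>B\<close>
  with the restriction of the one on \<open>C\<close>. As \<open>i\<close> is multiplicative, this restriction factors through the
  multiplication of \<open>B\<close>, and a pairing of the form \<open>\<phi> \<circ> m\<close> is invariant by associativity.\<close>

lemma invariant_duality_pullback:
  assumes C: "frobenius_algebra M C" and B: "unital_algebra M B"
    and i: "unital_algebra_morphism M B C i"
    and D: "left_dual M (ob B) D" and ob: "dual_ob D = ob B"
    and p: "dual_mor M D (frobenius_dual M C) i \<cdot> i = Idt (ob B)"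
  shows "invariant_duality M B D"
proof -
  let ?p = "dual_mor M D (frobenius_dual M C) i"
  note DC = left_dual_frobenius_dual[OF C]
  have [simp]: "ob C \<in> objs M" "mult C \<in> arrs M" "src M (mult C) = ob C \<boxtimes> ob C"
    "trg M (mult C) = ob C" "counit C \<in> arrs M" "src M (counit C) = ob C" "trg M (counit C) = \<one>"
    using C by (auto simp: frobenius_algebra_def unital_algebra_def counital_coalgebra_def hom_def)
  have [simp]: "ob B \<in> objs M" "mult B \<in> arrs M" "src M (mult B) = ob B \<boxtimes> ob B"
    "trg M (mult B) = ob B"
    and assoc: "mult B \<cdot> (mult B \<otimes> Idt (ob B)) = mult B \<cdot> (Idt (ob B) \<otimes> mult B)"
    using B by (auto simp: unital_algebra_def hom_def)
  have ih: "i \<in> hom M (ob B) (ob C)" and i_mult: "mult C \<cdot> (i \<otimes> i) = i \<cdot> mult B"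
    using i by (auto simp: unital_algebra_morphism_def)
  have [simp]: "i \<in> arrs M" "src M i = ob B" "trg M i = ob C"
    using ih by (auto simp: hom_def)
  have [simp]: "?p \<in> arrs M" "src M ?p = ob C" "trg M ?p = ob B"
    using dual_mor_in[OF D DC ih] ob by (auto simp: hom_def)
  note [simp] = left_dual_typing[OF D, unfolded ob]
  have "ev D = ev D \<cdot> ((?p \<cdot> i) \<otimes> Idt (ob B))"
    by (simp add: p)
  also have "\<dots> = (ev D \<cdot> (?p \<otimes> Idt (ob B))) \<cdot> (i \<otimes> Idt (ob B))"
    by simp
  also have "\<dots> = counit C \<cdot> (mult C \<cdot> (i \<otimes> i))"
    unfolding ev_dual_mor[OF D DC ih] by simp
  also have "\<dots> = (counit C \<cdot> i) \<cdot> mult B"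
    unfolding i_mult by simp
  finally have "ev D = (counit C \<cdot> i) \<cdot> mult B" .
  then have "ev D \<cdot> (mult B \<otimes> Idt (ob B)) = ev D \<cdot> (Idt (ob B) \<otimes> mult B)"
    by (simp add: assoc)
  then show ?thesis
    by unfold_locales (use B D ob in simp_all)
qed

end

theorem proposition3p24:
  fixes M :: "('o, 'm) smc"
    and C :: "('o, 'm) frobenius_data"
    and B :: "('o, 'm) algebra_data"
    and i\<^sub>B :: "'m"
    and D :: "('o, 'm) dual_data"
  assumes "karoubian_strict_monoidal_category M"
    and "frobenius_algebra M C"
    and "unital_algebra M B"
    and "unital_algebra_mono M B C i\<^sub>B"
    and "left_dual M (ob B) D"
  shows "ambiently_selfdual M (ob C) (frobenius_dual M C) (ob B) i\<^sub>B (dual_mor M D (frobenius_dual M C) i\<^sub>B)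
     \<longleftrightarrow> frobenius_subalgebra_by_dual M B D i\<^sub>B C"
proof -
  interpret karoubian_strict_monoidal_category M by fact
  let ?E = "frobenius_dual M C" and ?F = "dual_frobenius_data M B D"
  let ?p = "dual_mor M D ?E i\<^sub>B"
  note E = left_dual_frobenius_dual[OF assms(2)] and D = assms(5)
  have i_mor: "unital_algebra_morphism M B C i\<^sub>B"
    using assms(4) by (simp add: unital_algebra_mono_def)
  then have i: "i\<^sub>B \<in> hom M (ob B) (ob C)"
    by (simp add: unital_algebra_morphism_def)
  have p: "?p \<in> hom M (ob C) (dual_ob D)"
    using dual_mor_in[OF D E i] by simp
  have B: "ob B \<in> objs M"
    using left_dual_typing(1)[OF D] .
  have F: "ob ?F = ob B" "mult ?F = mult B" "unt ?F = unt B"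
    by (simp_all add: dual_frobenius_data_def)
  have mono: "unital_algebra_mono M ?F C i\<^sub>B"
    using assms(4) by (simp add: unital_algebra_mono_def unital_algebra_morphism_def F)
  show ?thesis
  proof
    assume "ambiently_selfdual M (ob C) ?E (ob B) i\<^sub>B ?p"
    then have p': "?p \<in> hom M (ob C) (ob B)" and retract: "?p \<cdot>\<^bsub>M\<^esub> i\<^sub>B = Idt\<^bsub>M\<^esub> (ob B)"
      and self: "dual_mor M ?E ?E (i\<^sub>B \<cdot>\<^bsub>M\<^esub> ?p) = i\<^sub>B \<cdot>\<^bsub>M\<^esub> ?p"
      by (auto simp: ambiently_selfdual_def split_subobject_def ambient_dual_def splits_def)
    from p p' have ob: "dual_ob D = ob B" by (auto simp: hom_def)
    have "dual_mor M ?E D ?p = i\<^sub>B"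
      using dual_retract_selfadjoint_iff[OF D E _ ob i retract] self by simp
    interpret invariant_duality M B D
      by (rule invariant_duality_pullback[OF assms(2,3) i_mor D ob retract])
    show "frobenius_subalgebra_by_dual M B D i\<^sub>B C"
      using frobenius_algebra_dual_frobenius_data frobenius_dual_dual_frobenius_data
        \<open>dual_mor M ?E D ?p = i\<^sub>B\<close> retract mono assms(2)
      by (simp add: frobenius_subalgebra_by_dual_def frobenius_subalgebra_def F)
  next
    assume "frobenius_subalgebra_by_dual M B D i\<^sub>B C"
    then have D_eq: "frobenius_dual M ?F = D" and sub: "frobenius_subalgebra M ?F i\<^sub>B C"
      by (simp_all add: frobenius_subalgebra_by_dual_def)
    have ob: "dual_ob D = ob B"
      using arg_cong[OF D_eq, of dual_ob] by (simp add: F)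
    from sub have "dual_mor M ?E D ?p = i\<^sub>B" and retract: "?p \<cdot>\<^bsub>M\<^esub> i\<^sub>B = Idt\<^bsub>M\<^esub> (ob B)"
      by (simp_all add: frobenius_subalgebra_def Let_def D_eq F)
    then have "dual_mor M ?E ?E (i\<^sub>B \<cdot>\<^bsub>M\<^esub> ?p) = i\<^sub>B \<cdot>\<^bsub>M\<^esub> ?p"
      using dual_retract_selfadjoint_iff[OF D E _ ob i retract] by simp
    then show "ambiently_selfdual M (ob C) ?E (ob B) i\<^sub>B ?p"
      using E B i p retract
      by (simp add: ambiently_selfdual_def selfduality_def split_subobject_def ambient_dual_def
          splits_def ob)
  qed
qed

end
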